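(* Let $K\subseteq k((G))$ be a Hahn field satisfying the canonical second lifting property and let $U$ be the group of units of its valuation ring. Restricting the isomorphism $\mathcal S\colon(\mathrm{IntAut}_k^{+}K,\circ)\to(\mathrm{Hom}^+(G,U),\times)$, $\sigma\mapsto[g\mapsto t^{-g}\sigma(t^g)]$, one obtains isomorphisms \begin{align*} (G\text{-}\mathrm{Exp}\,K,\circ)&\simeq(\mathrm{Hom}(G,k^\times),\times)=(\mathrm{Hom}(G,k^\times),\cdot),\\ (1\text{-}\mathrm{Aut}_k^{+}K,\circ)&\simeq(\mathrm{Hom}^+(G,1+I_K),\times), \end{align*} and thus \[ (\mathrm{Hom}^+(G,U),\times)\simeq(\mathrm{Hom}^+(G,1+I_K),\times)\rtimes(\mathrm{Hom}(G,k^\times),\cdot). \]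
   Context: Let $k$ be a field and $(G,+,<)$ a totally ordered abelian group. $\mathbb K=k((G))$ is the field of all formal series $a=\sum_{g\in G}a_gt^g$ ($a_g\in k$) whose support $\operatorname{supp}a=\{g:a_g\neq 0\}$ is well ordered, with termwise addition and convolution product. $k(G)\subseteq\mathbb K$ is the fraction field of the group ring $k[G]$ (series with finite support). A Hahn field is a field $K$ with $k(G)\subseteq K\subseteq \mathbb K$. It carries the valuation $v(a)=\min\operatorname{supp}a$ for $a\neq0$, $v(0)=\infty$, with value group $G$, valuation ring $R_K=\{v\geq0\}$, valuation ideal $I_K=\{v>0\}$ and unit group $U=\{a\in K:v(a)=0\}$. $v\text{-}\mathrm{Aut}\,K$ is the group of field automorphisms $\sigma$ of $K$ for which there is an order preserving automorphism $\sigma_G$ of $G$ with $\sigma_G(v(a))=v(\sigma(a))$ for all $a\in K^\times$. Such $\sigma$ induces the automorphism $\bar\sigma(a+I_K)=\sigma(a)+I_K$ of the residue field $R_K/I_K$. Put $\mathrm{IntAut}\,K:=\{\sigma\in v\text{-}\mathrm{Aut}\,K:\sigma_G=\mathrm{id},\ \bar\sigma=\mathrm{id}\}$ and $1\text{-}\mathrm{Aut}\,K:=\{\sigma\in\mathrm{IntAut}\,K:\sigma(t^g)_g=1\text{ for all }g\in G\}$. The subscript $k$ denotes the subgroup of those $\sigma$ with $\sigma|_k=\mathrm{id}_k$. $\mathrm{Hom}(G,k^\times)$ is the group, under pointwise multiplication $\cdot$, of homomorphisms $x\colon(G,+)\to(k^\times,\cdot)$, $x^g:=x(g)$. $K$ has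 the canonical second lifting property if $x\mapsto\rho_x$, $\rho_x(\sum a_gt^g)=\sum a_gx^gt^g$, is a well defined group homomorphism $\mathrm{Hom}(G,k^\times)\to\mathrm{IntAut}\,K$; its image is $G\text{-}\mathrm{Exp}\,K$. A family $\{a_{(i)}\}_{i\in I}\subseteq\mathbb K$ is summable if $\bigcup_i\operatorname{supp}a_{(i)}$ is well ordered and each $g$ lies in $\operatorname{supp}a_{(i)}$ for only finitely many $i$; its sum is then $\sum_ia_{(i)}:=\sum_g\big(\sum_i(a_{(i)})_g\big)t^g\in\mathbb K$. It is $K$-summable if it is a summable family of elements of $K$ whose sum lies in $K$. A map $\sigma\colon K\to K$ is $K$-summable if for every $a=\sum a_gt^g\in K$ the family $\{\sigma(a_gt^g):g\in\operatorname{supp}a\}$ is $K$-summable with sum $\sigma(a)$. $\sigma\in v\text{-}\mathrm{Aut}\,K$ is strongly additive if both $\sigma$ and $\sigma^{-1}$ are $K$-summable. The superscript $+$ on a group of automorphisms denotes its subgroup of strongly additive elements. $\mathrm{Hom}^+(G,U)$ is the set of homomorphisms $u\colon(G,+)\to(U,\cdot)$ such that for every $a\in K$ the family $\{a_gu(g)t^g:g\in\operatorname{supp}a\}$ is $K$-summable, and $\mathrm{Hom}^+(G,1+I_K)=\mathrm{Hom}^+(G,U)\cap\mathrm{Hom}(G,1+I_K)$. The operation $\times$ on $\mathrm{Hom}^+(G,U)$ is $(u\times w)(g)=\tau_u(w(g))\,u(g)$, where $\tau_u(\sum a_gt^g)=\sum a_gu(g)t^g$ on $K$. The map $\mathcal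 S$ of the claim is a group isomorphism. The semi-direct product has its normal factor on the left and is inner (for the operation $\times$). *)

theory Defs
  imports "HOL-Algebra.Bij" "HOL-Algebra.QuotRing" "HOL-Library.Extended"
begin

section \<open>Hahn series\<close>

text \<open>The coefficient field \<open>k\<close> and the ordered exponent group \<open>G\<close> are the types
  \<open>'k::field\<close> and \<open>'g::linordered_ab_group_add\<close>; a series is its coefficient function.\<close>

type_synonym ('g, 'k) series = "'g \<Rightarrow> 'k"

definition hsupp :: "('g, 'k::zero) series \<Rightarrow> 'g set" where
  "hsupp a = {g. a g \<noteq> 0}"

definition hmonom :: "'k::zero \<Rightarrow> 'g \<Rightarrow> ('g, 'k) series" where
  "hmonom c g = (\<lambda>h. if h = g then c else 0)"

definition hconst :: "'k::zero \<Rightarrow> ('g::zero, 'k) series" where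
  "hconst c = hmonom c 0"

text \<open>On a linear order, \<open>wfp_on S (<)\<close> says that \<open>S\<close> is well ordered. The index set of the
  convolution sum is finite when both supports are well ordered.\<close>

definition hahn_ring :: "('g::linordered_ab_group_add, 'k::field) series ring" where
  "hahn_ring =
    \<lparr>carrier = {a. wfp_on (hsupp a) (<)},
     mult = \<lambda>a b g. \<Sum>h \<in> {h \<in> hsupp a. g - h \<in> hsupp b}. a h * b (g - h),
     one = hconst 1,
     zero = (\<lambda>_. 0),
     add = \<lambda>a b g. a g + b g\<rparr>"

definition group_ring :: "('g::linordered_ab_group_add, 'k::field) series set" where
  "group_ring = {a. finite (hsupp a)}"

definition rational_series :: "('g::linordered_ab_group_add, 'k::field) series set" where
  "rational_series =
    {p \<otimes>\<^bsub>hahn_ring\<^esub> inv\<^bsub>hahn_ring\<^esub> q | p q. p \<in> group_ring \<and> q \<in> group_ring - {\<zero>\<^bsub>hahn_ring\<^esub>}}"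

abbreviation ring_on :: "('g::linordered_ab_group_add, 'k::field) series set \<Rightarrow> ('g, 'k) series ring" where
  "ring_on K \<equiv> hahn_ring\<lparr>carrier := K\<rparr>"

definition hahn_field :: "('g::linordered_ab_group_add, 'k::field) series set \<Rightarrow> bool" where
  "hahn_field K \<longleftrightarrow>
    field (ring_on K) \<and> rational_series \<subseteq> K \<and> K \<subseteq> carrier hahn_ring"

text \<open>The value \<open>Minf\<close> of the library type is never taken.\<close>

definition hval :: "('g::linordered_ab_group_add, 'k::field) series \<Rightarrow> 'g extended" where
  "hval a = (if a = \<zero>\<^bsub>hahn_ring\<^esub> then Pinf else Fin (LEAST g. g \<in> hsupp a))"

definition val_ring :: "('g::linordered_ab_group_add, 'k::field) series set \<Rightarrow> ('g, 'k) series set" where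
  "val_ring K = {a \<in> K. 0 \<le> hval a}"

definition val_ideal :: "('g::linordered_ab_group_add, 'k::field) series set \<Rightarrow> ('g, 'k) series set" where
  "val_ideal K = {a \<in> K. 0 < hval a}"

definition val_units :: "('g::linordered_ab_group_add, 'k::field) series set \<Rightarrow> ('g, 'k) series set" where
  "val_units K = {a \<in> K. hval a = 0}"

definition one_units :: "('g::linordered_ab_group_add, 'k::field) series set \<Rightarrow> ('g, 'k) series set" where
  "one_units K = {\<one>\<^bsub>hahn_ring\<^esub> \<oplus>\<^bsub>hahn_ring\<^esub> a | a. a \<in> val_ideal K}"

text \<open>\<open>k\<close> is identified with the constant series.\<close>

definition coeff_units :: "('g::linordered_ab_group_add, 'k::field) series set" where
  "coeff_units = hconst ` (UNIV - {0})"


section \<open>Valuation preserving automorphisms\<close>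

text \<open>\<open>induces K \<sigma> s\<close>: \<open>s\<close> is the (unique) automorphism \<open>\<sigma>\<^sub>G\<close> of the ordered group \<open>G\<close>.
  As in the library theory of bijection groups, automorphisms of \<open>K\<close> are extensional functions.\<close>

definition induces ::
  "('g::linordered_ab_group_add, 'k::field) series set \<Rightarrow> (('g, 'k) series \<Rightarrow> ('g, 'k) series) \<Rightarrow> ('g \<Rightarrow> 'g) \<Rightarrow> bool"
  where
  "induces K \<sigma> s \<longleftrightarrow>
    bij s \<and> (\<forall>g h. s (g + h) = s g + s h) \<and> strict_mono s \<and>
    (\<forall>a \<in> K - {\<zero>\<^bsub>hahn_ring\<^esub>}. map_extended s (hval a) = hval (\<sigma> a))"

definition val_Aut ::
  "('g::linordered_ab_group_add, 'k::field) series set \<Rightarrow> (('g, 'k) series \<Rightarrow> ('g, 'k) series) set" where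
  "val_Aut K = {\<sigma> \<in> extensional K. \<sigma> \<in> ring_iso (ring_on K) (ring_on K) \<and> (\<exists>s. induces K \<sigma> s)}"

definition Int_Aut ::
  "('g::linordered_ab_group_add, 'k::field) series set \<Rightarrow> (('g, 'k) series \<Rightarrow> ('g, 'k) series) set" where
  "Int_Aut K = {\<sigma> \<in> val_Aut K. induces K \<sigma> id \<and>
    (\<forall>a \<in> val_ring K. val_ideal K +>\<^bsub>ring_on K\<^esub> \<sigma> a = val_ideal K +>\<^bsub>ring_on K\<^esub> a)}"

definition one_Aut ::
  "('g::linordered_ab_group_add, 'k::field) series set \<Rightarrow> (('g, 'k) series \<Rightarrow> ('g, 'k) series) set" where
  "one_Aut K = {\<sigma> \<in> Int_Aut K. \<forall>g. \<sigma> (hmonom 1 g) g = 1}"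

definition over_k ::
  "(('g::linordered_ab_group_add, 'k::field) series \<Rightarrow> ('g, 'k) series) set \<Rightarrow> (('g, 'k) series \<Rightarrow> ('g, 'k) series) set"
  where
  "over_k A = {\<sigma> \<in> A. \<forall>c. \<sigma> (hconst c) = hconst c}"

definition aut_group ::
  "('g, 'k) series set \<Rightarrow> (('g, 'k) series \<Rightarrow> ('g, 'k) series) set \<Rightarrow> (('g, 'k) series \<Rightarrow> ('g, 'k) series) monoid"
  where
  "aut_group K A = (BijGroup K)\<lparr>carrier := A\<rparr>"


section \<open>Summability\<close>

definition summable_family :: "('i \<Rightarrow> ('g::linordered_ab_group_add, 'k::field) series) \<Rightarrow> 'i set \<Rightarrow> bool" where
  "summable_family F I \<longleftrightarrow>
    wfp_on (\<Union>i\<in>I. hsupp (F i)) (<) \<and> (\<forall>g. finite {i \<in> I. g \<in> hsupp (F i)})"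

definition family_sum ::
  "('i \<Rightarrow> ('g::linordered_ab_group_add, 'k::field) series) \<Rightarrow> 'i set \<Rightarrow> ('g, 'k) series" where
  "family_sum F I = (\<lambda>g. \<Sum>i \<in> {i \<in> I. g \<in> hsupp (F i)}. F i g)"

definition K_summable ::
  "('g::linordered_ab_group_add, 'k::field) series set \<Rightarrow> ('i \<Rightarrow> ('g, 'k) series) \<Rightarrow> 'i set \<Rightarrow> bool" where
  "K_summable K F I \<longleftrightarrow> summable_family F I \<and> (\<forall>i\<in>I. F i \<in> K) \<and> family_sum F I \<in> K"

definition K_summable_map ::
  "('g::linordered_ab_group_add, 'k::field) series set \<Rightarrow> (('g, 'k) series \<Rightarrow> ('g, 'k) series) \<Rightarrow> bool" where
  "K_summable_map K \<sigma> \<longleftrightarrow> (\<forall>a\<in>K.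
    K_summable K (\<lambda>g. \<sigma> (hmonom (a g) g)) (hsupp a) \<and>
    family_sum (\<lambda>g. \<sigma> (hmonom (a g) g)) (hsupp a) = \<sigma> a)"

definition strongly_additive ::
  "('g::linordered_ab_group_add, 'k::field) series set \<Rightarrow> (('g, 'k) series \<Rightarrow> ('g, 'k) series) \<Rightarrow> bool" where
  "strongly_additive K \<sigma> \<longleftrightarrow> K_summable_map K \<sigma> \<and> K_summable_map K (inv_into K \<sigma>)"

definition strong_part ::
  "('g::linordered_ab_group_add, 'k::field) series set \<Rightarrow> (('g, 'k) series \<Rightarrow> ('g, 'k) series) set
    \<Rightarrow> (('g, 'k) series \<Rightarrow> ('g, 'k) series) set" where
  "strong_part K A = {\<sigma> \<in> A. strongly_additive K \<sigma>}"


section \<open>Homomorphisms from \<open>G\<close> into multiplicative groups of series\<close>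

definition Hom_G ::
  "('g::linordered_ab_group_add, 'k::field) series set \<Rightarrow> ('g \<Rightarrow> ('g, 'k) series) set" where
  "Hom_G M = hom \<lparr>carrier = UNIV, mult = (+), one = 0\<rparr>
                 \<lparr>carrier = M, mult = mult hahn_ring, one = \<one>\<^bsub>hahn_ring\<^esub>\<rparr>"

text \<open>In the groups below the multiplication is made extensional on the carrier \<open>A\<close>, as in
  the library's bijection group, so that two of them are equal exactly when they have the same
  elements and the operations agree on these.\<close>

definition pointwise_group ::
  "('g \<Rightarrow> ('g::linordered_ab_group_add, 'k::field) series) set \<Rightarrow> ('g \<Rightarrow> ('g, 'k) series) monoid" where
  "pointwise_group A =
    \<lparr>carrier = A,
     mult = (\<lambda>u\<in>A. \<lambda>w\<in>A. \<lambda>g. u g \<otimes>\<^bsub>hahn_ring\<^esub> w g),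
     one = (\<lambda>_. \<one>\<^bsub>hahn_ring\<^esub>)\<rparr>"

definition Hom_plus ::
  "('g::linordered_ab_group_add, 'k::field) series set \<Rightarrow> ('g \<Rightarrow> ('g, 'k) series) set" where
  "Hom_plus K = {u \<in> Hom_G (val_units K).
    \<forall>a\<in>K. K_summable K (\<lambda>g. hmonom (a g) g \<otimes>\<^bsub>hahn_ring\<^esub> u g) (hsupp a)}"

definition Hom_plus_one ::
  "('g::linordered_ab_group_add, 'k::field) series set \<Rightarrow> ('g \<Rightarrow> ('g, 'k) series) set" where
  "Hom_plus_one K = Hom_plus K \<inter> Hom_G (one_units K)"

definition tau ::
  "('g \<Rightarrow> ('g::linordered_ab_group_add, 'k::field) series) \<Rightarrow> ('g, 'k) series \<Rightarrow> ('g, 'k) series" where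
  "tau u a = family_sum (\<lambda>g. hmonom (a g) g \<otimes>\<^bsub>hahn_ring\<^esub> u g) (hsupp a)"

definition times_group ::
  "('g \<Rightarrow> ('g::linordered_ab_group_add, 'k::field) series) set \<Rightarrow> ('g \<Rightarrow> ('g, 'k) series) monoid" where
  "times_group A =
    \<lparr>carrier = A,
     mult = (\<lambda>u\<in>A. \<lambda>w\<in>A. \<lambda>g. tau u (w g) \<otimes>\<^bsub>hahn_ring\<^esub> u g),
     one = (\<lambda>_. \<one>\<^bsub>hahn_ring\<^esub>)\<rparr>"


section \<open>The canonical second lifting property and the map \<open>\<S>\<close>\<close>

text \<open>Since \<open>x g\<close> is a constant series, the scalar \<open>x\<^sup>g\<close> is its coefficient at \<open>0\<close>.\<close>

definition rho ::
  "('g::linordered_ab_group_add, 'k::field) series set \<Rightarrow> ('g \<Rightarrow> ('g, 'k) series)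
    \<Rightarrow> ('g, 'k) series \<Rightarrow> ('g, 'k) series" where
  "rho K x = (\<lambda>a\<in>K. \<lambda>g. a g * x g 0)"

definition second_lifting :: "('g::linordered_ab_group_add, 'k::field) series set \<Rightarrow> bool" where
  "second_lifting K \<longleftrightarrow>
    rho K \<in> hom (pointwise_group (Hom_G coeff_units)) (aut_group K (Int_Aut K))"

definition G_Exp ::
  "('g::linordered_ab_group_add, 'k::field) series set \<Rightarrow> (('g, 'k) series \<Rightarrow> ('g, 'k) series) set" where
  "G_Exp K = rho K ` Hom_G coeff_units"

definition S_map ::
  "(('g::linordered_ab_group_add, 'k::field) series \<Rightarrow> ('g, 'k) series) \<Rightarrow> 'g \<Rightarrow> ('g, 'k) series" where
  "S_map \<sigma> = (\<lambda>g. hmonom 1 (- g) \<otimes>\<^bsub>hahn_ring\<^esub> \<sigma> (hmonom 1 g))"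

text \<open>That \<open>\<S>\<close> is an isomorphism of groups is a standing assumption about \<open>K\<close>, which does not
  follow from the definitions: for \<open>K = k(t)\<close>, \<open>G = \<int>\<close>, the map \<open>u n = (1 + t)^n\<close> lies in
  \<open>Hom_plus K\<close>, but no automorphism of \<open>K\<close> sends \<open>t\<close> to \<open>t + t^2\<close>. A group isomorphism
  is between groups, which is not part of the library's \<open>iso\<close>.\<close>

definition S_isomorphism :: "('g::linordered_ab_group_add, 'k::field) series set \<Rightarrow> bool" where
  "S_isomorphism K \<longleftrightarrow>
    group (aut_group K (strong_part K (over_k (Int_Aut K)))) \<and>
    group (times_group (Hom_plus K)) \<and>
    S_map \<in> iso (aut_group K (strong_part K (over_k (Int_Aut K)))) (times_group (Hom_plus K))"

text \<open>\<open>G\<close> is the inner semi-direct product of its normal subgroup \<open>N\<close> and its subgroup \<open>H\<close>.\<close>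

definition inner_semidirect :: "('a, 'b) monoid_scheme \<Rightarrow> 'a set \<Rightarrow> 'a set \<Rightarrow> bool" where
  "inner_semidirect G N H \<longleftrightarrow>
    N \<lhd> G \<and> subgroup H G \<and> N \<inter> H = {\<one>\<^bsub>G\<^esub>} \<and> N <#>\<^bsub>G\<^esub> H = carrier G"

end

theory Submission
  imports Defs
begin

text \<open>Everything rests on a single homomorphism, the leading character. A unit of the valuation
  ring has all its exponents nonnegative and a nonzero coefficient at \<open>0\<close>, so sending \<open>u\<close> to the
  function \<open>g \<mapsto> (u g)\<^sub>0\<close> turns a homomorphism from \<open>G\<close> to \<open>U\<close> into one from \<open>G\<close> to the nonzero
  scalars. The operation \<open>\<times>\<close> differs from the pointwise product only by the substitution
  \<open>\<tau>\<^sub>u\<close>, and \<open>\<tau>\<^sub>u\<close> replaces \<open>t\<^sup>g\<close> by \<open>t\<^sup>g\<close> times a unit. On a series with nonnegative exponents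
  this creates no negative exponents and leaves the coefficient at \<open>0\<close> alone, since \<open>u 0 = 1\<close>.
  Hence the leading character is a homomorphism from \<open>(Hom\<^sup>+(G,U), \<times>)\<close> to the pointwise group
  \<open>Hom(G,k\<^sup>\<times>)\<close> (lemma \<open>leading_char_hom\<close>). Its kernel is \<open>Hom\<^sup>+(G,1+I\<^sub>K)\<close>, because a unit of the
  valuation ring is in \<open>1+I\<^sub>K\<close> exactly when its coefficient at \<open>0\<close> is \<open>1\<close>.

  The substitutions \<open>\<rho>\<^sub>x\<close> only rescale coefficients. They fix the constants, since \<open>x\<^sup>0 = 1\<close>, and
  they are strongly additive, since they send monomials to monomials and the inverse of \<open>\<rho>\<^sub>x\<close> is
  the substitution of the inverse character. So the second lifting property yields a homomorphism
  from \<open>Hom(G,k\<^sup>\<times>)\<close> into the strongly additive part of \<open>IntAut\<^sub>k K\<close> (lemma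
  \<open>rho_hom_strong_part\<close>), and \<open>\<S> \<rho>\<^sub>x = x\<close>. Its image \<open>G-Exp K\<close> is therefore a subgroup which \<open>\<S>\<close>
  carries onto \<open>Hom(G,k\<^sup>\<times>)\<close>, and the latter becomes a subgroup of \<open>Hom\<^sup>+(G,U)\<close>. The leading
  character is the identity on it, so it is a retraction of \<open>Hom\<^sup>+(G,U)\<close> onto this subgroup, and
  a group is the semi-direct product of the kernel of a retraction and its image.

  Finally \<open>\<sigma>(t\<^sup>g)\<^sub>g\<close> is the coefficient of \<open>\<S> \<sigma> g\<close> at \<open>0\<close>, so the strongly additive part of
  \<open>1-Aut\<^sub>k K\<close> is the kernel of the leading character composed with \<open>\<S>\<close>. It is a subgroup that \<open>\<S>\<close>
  carries onto \<open>Hom\<^sup>+(G,1+I\<^sub>K)\<close>.\<close>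

section \<open>Monomials and constant series\<close>

lemma hsupp_hmonom: "hsupp (hmonom c g) = (if c = 0 then {} else {g})"
  by (auto simp: hsupp_def hmonom_def)

lemma one_hahn_ring: "\<one>\<^bsub>hahn_ring\<^esub> = hconst 1"
  by (simp add: hahn_ring_def)

lemma mult_coeff:
  "(a \<otimes>\<^bsub>hahn_ring\<^esub> b) g = (\<Sum>h \<in> {h \<in> hsupp a. g - h \<in> hsupp b}. a h * b (g - h))"
  by (simp add: hahn_ring_def)

lemma hmonom_mult: "hmonom c g \<otimes>\<^bsub>hahn_ring\<^esub> b = (\<lambda>h. c * b (h - g))"
proof
  fix h
  have "{i \<in> hsupp (hmonom c g). h - i \<in> hsupp b} = (if c = 0 \<or> b (h - g) = 0 then {} else {g})"
    by (auto simp: hsupp_hmonom hsupp_def[of b])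
  then show "(hmonom c g \<otimes>\<^bsub>hahn_ring\<^esub> b) h = c * b (h - g)"
    by (simp add: mult_coeff hmonom_def)
qed

lemma hmonom_mult_hmonom:
  "hmonom c g \<otimes>\<^bsub>hahn_ring\<^esub> hmonom d h = hmonom (c * d) (g + h)"
  unfolding hmonom_mult by (auto simp: hmonom_def fun_eq_iff algebra_simps)

lemma hconst_mult_hconst: "hconst a \<otimes>\<^bsub>hahn_ring\<^esub> hconst b = hconst (a * b)"
  by (simp add: hconst_def hmonom_mult_hmonom)

lemma hconst_eq_iff: "hconst a = hconst b \<longleftrightarrow> a = b"
  by (auto simp: hconst_def hmonom_def fun_eq_iff)

text \<open>The inverse in \<open>rational_series\<close> is a definite description in the ring of all Hahn series,
  so its value is found by exhibiting it and using the left unit law for uniqueness.\<close>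

lemma inv_one_hahn_ring:
  "inv\<^bsub>hahn_ring\<^esub> hconst 1 = (hconst 1 :: ('g::linordered_ab_group_add, 'k::field) series)"
proof -
  have 1: "hconst 1 \<otimes>\<^bsub>hahn_ring\<^esub> y = y" for y :: "('g, 'k) series"
    by (simp add: hconst_def hmonom_mult)
  have "(hconst 1 :: ('g, 'k) series) \<in> carrier hahn_ring"
    by (auto simp: hahn_ring_def hconst_def hsupp_hmonom wfp_on_iff_ex_minimal)
  then show ?thesis
    unfolding m_inv_def by (intro the_equality) (auto simp: one_hahn_ring 1)
qed

text \<open>A monomial is the fraction of itself by \<open>1\<close>. This puts the arguments of \<open>\<rho>\<^sub>x\<close>, of \<open>\<S>\<close> and of
  the summability conditions into \<open>K\<close>, where the extensional maps take their intended values.\<close>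

lemma hmonom_in_hahn_field:
  assumes "hahn_field K"
  shows "hmonom c g \<in> K"
proof -
  have "hmonom c g = hmonom c g \<otimes>\<^bsub>hahn_ring\<^esub> inv\<^bsub>hahn_ring\<^esub> hconst 1"
    by (subst inv_one_hahn_ring) (simp add: hconst_def hmonom_mult_hmonom)
  moreover have "hmonom c g \<in> group_ring" "hconst 1 \<in> group_ring - {\<zero>\<^bsub>hahn_ring\<^esub>}"
    using hconst_eq_iff[of 1 0]
    by (auto simp: group_ring_def hconst_def hsupp_hmonom hahn_ring_def)
      (auto simp: hmonom_def)
  ultimately have "hmonom c g \<in> rational_series"
    unfolding rational_series_def by blast
  with assms show ?thesis
    by (auto simp: hahn_field_def)
qed

lemma family_sum_hmonom:
  assumes "\<And>i. i \<in> S \<Longrightarrow> f i \<noteq> 0"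
  shows "family_sum (\<lambda>i. hmonom (f i) i) S = (\<lambda>g. if g \<in> S then f g else 0)"
proof
  fix g
  have "{i \<in> S. g \<in> hsupp (hmonom (f i) i)} = S \<inter> {g}"
    using assms by (auto simp: hsupp_hmonom split: if_splits)
  then show "family_sum (\<lambda>i. hmonom (f i) i) S g = (if g \<in> S then f g else 0)"
    by (simp add: family_sum_def hmonom_def)
qed

lemma summable_family_hmonom:
  assumes "wfp_on S (<)" "\<And>i. i \<in> S \<Longrightarrow> f i \<noteq> 0"
  shows "summable_family (\<lambda>i. hmonom (f i) i) S"
proof -
  have "(\<Union>i\<in>S. hsupp (hmonom (f i) i)) = S"
    using assms(2) by (auto simp: hsupp_hmonom)
  moreover have "{i \<in> S. g \<in> hsupp (hmonom (f i) i)} \<subseteq> {g}" for g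
    by (auto simp: hsupp_hmonom split: if_splits)
  ultimately show ?thesis
    using assms(1) unfolding summable_family_def by (auto intro: finite_subset)
qed


section \<open>The valuation and the coefficient at zero\<close>

lemma least_hsupp:
  assumes "wfp_on (hsupp a) (<)" "a \<noteq> \<zero>\<^bsub>hahn_ring\<^esub>"
  obtains m where "m \<in> hsupp a" "\<And>g. g \<in> hsupp a \<Longrightarrow> m \<le> g" "hval a = Fin m"
proof -
  have "hsupp a \<noteq> {}"
    using assms(2) by (auto simp: hsupp_def hahn_ring_def)
  then obtain m where m: "m \<in> hsupp a" "\<And>y. y < m \<Longrightarrow> y \<notin> hsupp a"
    using assms(1) unfolding wfp_on_iff_ex_minimal by (metis order.refl)
  moreover have "m \<le> g" if "g \<in> hsupp a" for g
    using m(2)[of g] that by force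
  moreover from this m(1) have "(LEAST g. g \<in> hsupp a) = m"
    by (intro Least_equality)
  ultimately show thesis
    using that assms(2) by (auto simp: hval_def)
qed

lemma hval_eq_0_iff:
  assumes "wfp_on (hsupp a) (<)"
  shows "hval a = 0 \<longleftrightarrow> a 0 \<noteq> 0 \<and> (\<forall>g \<in> hsupp a. 0 \<le> g)"
proof (cases "a = \<zero>\<^bsub>hahn_ring\<^esub>")
  case True
  then show ?thesis by (auto simp: hval_def hahn_ring_def zero_extended_def)
next
  case False
  then obtain m where "m \<in> hsupp a" "\<And>g. g \<in> hsupp a \<Longrightarrow> m \<le> g" "hval a = Fin m"
    using assms least_hsupp by blast
  then show ?thesis
    by (auto simp: zero_extended_def hsupp_def intro: antisym)
qed

lemma hval_pos_iff:
  assumes "wfp_on (hsupp a) (<)"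
  shows "0 < hval a \<longleftrightarrow> (\<forall>g \<in> hsupp a. 0 < g)"
proof (cases "a = \<zero>\<^bsub>hahn_ring\<^esub>")
  case True
  then show ?thesis by (auto simp: hval_def hahn_ring_def zero_extended_def hsupp_def)
next
  case False
  then obtain m where "m \<in> hsupp a" "\<And>g. g \<in> hsupp a \<Longrightarrow> m \<le> g" "hval a = Fin m"
    using assms least_hsupp by blast
  then show ?thesis
    by (auto simp: zero_extended_def intro: less_le_trans)
qed

lemma hahn_field_wf: "hahn_field K \<Longrightarrow> a \<in> K \<Longrightarrow> wfp_on (hsupp a) (<)"
  by (auto simp: hahn_field_def hahn_ring_def)

lemma val_units_iff:
  assumes "hahn_field K"
  shows "a \<in> val_units K \<longleftrightarrow> a \<in> K \<and> a 0 \<noteq> 0 \<and> (\<forall>g \<in> hsupp a. 0 \<le> g)"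
  using hval_eq_0_iff hahn_field_wf[OF assms] by (auto simp: val_units_def)

text \<open>The condition that \<open>1\<close> is the coefficient at \<open>0\<close> is what the kernel of the leading character
  expresses. In the direction from right to left, subtracting \<open>1\<close> cancels that coefficient and
  leaves only positive exponents.\<close>

lemma one_units_iff:
  assumes "hahn_field K"
  shows "a \<in> one_units K \<longleftrightarrow> a \<in> val_units K \<and> a 0 = 1"
proof
  interpret field "ring_on K"
    using assms by (simp add: hahn_field_def)
  have sum: "a \<oplus>\<^bsub>hahn_ring\<^esub> b = (\<lambda>g. a g + b g)" for a b :: "('a, 'b) series"
    by (simp add: hahn_ring_def)
  show "a \<in> val_units K \<and> a 0 = 1" if a: "a \<in> one_units K"
  proof -
    obtain b where b: "a = hconst 1 \<oplus>\<^bsub>hahn_ring\<^esub> b" "b \<in> K" "0 < hval b"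
      using a by (auto simp: one_units_def val_ideal_def one_hahn_ring)
    then have pos: "\<And>g. b g \<noteq> 0 \<Longrightarrow> 0 < g"
      using hval_pos_iff[OF hahn_field_wf[OF assms b(2)]] by (auto simp: hsupp_def)
    have "a \<in> K"
      using a_closed[of "hconst 1" b] b hmonom_in_hahn_field[OF assms]
      by (simp add: hconst_def)
    moreover have "a 0 = 1"
      using pos[of 0] by (auto simp: b(1) sum hconst_def hmonom_def)
    moreover have "0 \<le> g" if "g \<in> hsupp a" for g
      using that pos[of g] by (auto simp: b(1) sum hconst_def hmonom_def hsupp_def split: if_splits)
    ultimately show ?thesis
      by (auto simp: val_units_iff[OF assms])
  qed
  show "a \<in> one_units K" if a: "a \<in> val_units K \<and> a 0 = 1"
  proof -
    define b where "b = hconst (-1) \<oplus>\<^bsub>hahn_ring\<^esub> a"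
    have "a \<in> K" and nonneg: "\<And>g. a g \<noteq> 0 \<Longrightarrow> 0 \<le> g"
      using a by (auto simp: val_units_iff[OF assms] hsupp_def)
    then have bK: "b \<in> K"
      using a_closed[of "hconst (-1)" a] hmonom_in_hahn_field[OF assms]
      by (simp add: hconst_def b_def)
    have "0 < g" if "g \<in> hsupp b" for g
      using that a nonneg[of g] by (auto simp: b_def sum hconst_def hmonom_def hsupp_def split: if_splits)
    then have "b \<in> val_ideal K"
      using bK hval_pos_iff[OF hahn_field_wf[OF assms bK]] by (auto simp: val_ideal_def)
    moreover have "a = hconst 1 \<oplus>\<^bsub>hahn_ring\<^esub> b"
      by (auto simp: b_def sum hconst_def hmonom_def)
    ultimately show ?thesis
      by (auto simp: one_units_def one_hahn_ring)
  qed
qed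

text \<open>Two nonnegative exponents with sum \<open>0\<close> are both \<open>0\<close>. On the valuation ring, the coefficient
  at \<open>0\<close> is the residue, so this is the multiplicativity of the residue map.\<close>

lemma mult_coeff_0:
  assumes "\<forall>g \<in> hsupp a. 0 \<le> g" "\<forall>g \<in> hsupp b. 0 \<le> g"
  shows "(a \<otimes>\<^bsub>hahn_ring\<^esub> b) 0 = a 0 * b 0"
proof -
  have "(a \<otimes>\<^bsub>hahn_ring\<^esub> b) 0 = (\<Sum>h \<in> {0}. a h * b (0 - h))"
    unfolding mult_coeff
  proof (rule sum.mono_neutral_left)
    have "h = 0" if "h \<in> hsupp a" "0 - h \<in> hsupp b" for h
      using that(1) assms(1)[rule_format, of h] assms(2)[rule_format, OF that(2)] by simp
    then show "{h \<in> hsupp a. 0 - h \<in> hsupp b} \<subseteq> {0}"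
      by blast
  qed (auto simp: hsupp_def)
  then show ?thesis
    by simp
qed


section \<open>Homomorphisms into the coefficients\<close>

lemma Hom_G_iff: "u \<in> Hom_G M \<longleftrightarrow> (\<forall>g. u g \<in> M) \<and> (\<forall>g h. u (g + h) = u g \<otimes>\<^bsub>hahn_ring\<^esub> u h)"
  by (auto simp: Hom_G_def hom_def)

lemma Hom_G_coeff_units_iff:
  "x \<in> Hom_G coeff_units \<longleftrightarrow>
    (\<exists>f. x = (\<lambda>g. hconst (f g)) \<and> (\<forall>g. f g \<noteq> 0) \<and> (\<forall>g h. f (g + h) = f g * f h))"
proof
  assume x: "x \<in> Hom_G coeff_units"
  then have "\<forall>g. \<exists>c. x g = hconst c \<and> c \<noteq> 0"
    by (auto simp: Hom_G_iff coeff_units_def)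
  then obtain f where f: "\<And>g. x g = hconst (f g)" "\<And>g. f g \<noteq> 0"
    by metis
  with x show "\<exists>f. x = (\<lambda>g. hconst (f g)) \<and> (\<forall>g. f g \<noteq> 0) \<and> (\<forall>g h. f (g + h) = f g * f h)"
    by (intro exI[of _ f]) (auto simp: Hom_G_iff hconst_mult_hconst hconst_eq_iff)
qed (auto simp: Hom_G_iff coeff_units_def hconst_mult_hconst)

text \<open>Values of a character in \<open>k\<close> are easier to compute with than constant series. The inverse
  character is included because it gives both inverses in \<open>Hom(G,k\<^sup>\<times>)\<close> and inverses of the
  substitutions \<open>\<rho>\<^sub>x\<close>.\<close>

lemma Hom_G_coeff_unitsE:
  assumes "x \<in> Hom_G coeff_units"
  obtains f where "x = (\<lambda>g. hconst (f g))" "\<And>g. f g \<noteq> 0" "\<And>g h. f (g + h) = f g * f h" "f 0 = 1"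
    "(\<lambda>g. hconst (inverse (f g))) \<in> Hom_G coeff_units"
proof -
  obtain f where f: "x = (\<lambda>g. hconst (f g))" "\<And>g. f g \<noteq> 0" "\<And>g h. f (g + h) = f g * f h"
    using assms by (auto simp: Hom_G_coeff_units_iff)
  moreover have "f 0 = 1"
    using f(2)[of 0] f(3)[of 0 0] by simp
  moreover have "(\<lambda>g. hconst (inverse (f g))) \<in> Hom_G coeff_units"
    unfolding Hom_G_coeff_units_iff using f(2,3) by (intro exI[of _ "\<lambda>g. inverse (f g)"]) simp
  ultimately show thesis
    using that by blast
qed

lemma group_pointwise_coeff_units:
  "group (pointwise_group (Hom_G (coeff_units :: ('g::linordered_ab_group_add, 'k::field) series set)))"
  (is "group ?P")
proof (rule groupI)
  have one: "\<one>\<^bsub>?P\<^esub> = (\<lambda>g. hconst 1)"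
    by (simp add: pointwise_group_def one_hahn_ring)
  have mult: "(\<lambda>g. hconst (f g)) \<otimes>\<^bsub>?P\<^esub> (\<lambda>g. hconst (f' g)) = (\<lambda>g. hconst (f g * f' g))"
    if "(\<lambda>g. hconst (f g)) \<in> carrier ?P" "(\<lambda>g. hconst (f' g)) \<in> carrier ?P" for f f' :: "'g \<Rightarrow> 'k"
    using that by (simp add: pointwise_group_def hconst_mult_hconst)
  have carrier: "carrier ?P = Hom_G coeff_units"
    by (simp add: pointwise_group_def)
  show one_closed: "\<one>\<^bsub>?P\<^esub> \<in> carrier ?P"
    by (auto simp: carrier one Hom_G_coeff_units_iff)
  fix x assume x: "x \<in> carrier ?P"
  then obtain f where f: "x = (\<lambda>g. hconst (f g))" "\<And>g. f g \<noteq> 0" "\<And>g h. f (g + h) = f g * f h"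
    "(\<lambda>g. hconst (inverse (f g))) \<in> Hom_G coeff_units"
    unfolding carrier by (auto elim: Hom_G_coeff_unitsE)
  show "\<one>\<^bsub>?P\<^esub> \<otimes>\<^bsub>?P\<^esub> x = x"
    using mult[of "\<lambda>_. 1" f] x one_closed by (simp add: one f(1))
  show "\<exists>y\<in>carrier ?P. y \<otimes>\<^bsub>?P\<^esub> x = \<one>\<^bsub>?P\<^esub>"
    using mult[of "\<lambda>g. inverse (f g)" f] x f
    by (intro bexI[of _ "\<lambda>g. hconst (inverse (f g))"]) (auto simp: carrier one)
  have closed: "x \<otimes>\<^bsub>?P\<^esub> y \<in> carrier ?P" if xy: "x \<in> carrier ?P" "y \<in> carrier ?P" for x y
  proof -
    obtain f f' where f: "x = (\<lambda>g. hconst (f g))" "\<And>g. f g \<noteq> 0" "\<And>g h. f (g + h) = f g * f h"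
      and f': "y = (\<lambda>g. hconst (f' g))" "\<And>g. f' g \<noteq> 0" "\<And>g h. f' (g + h) = f' g * f' h"
      using xy unfolding carrier by (metis Hom_G_coeff_unitsE)
    have "x \<otimes>\<^bsub>?P\<^esub> y = (\<lambda>g. hconst (f g * f' g))"
      using mult xy by (simp add: f(1) f'(1))
    then show ?thesis
      unfolding carrier Hom_G_coeff_units_iff using f f' by (intro exI[of _ "\<lambda>g. f g * f' g"]) auto
  qed
  fix y assume y: "y \<in> carrier ?P"
  show "x \<otimes>\<^bsub>?P\<^esub> y \<in> carrier ?P"
    using closed x y by blast
  fix z assume z: "z \<in> carrier ?P"
  obtain f' f'' where f': "y = (\<lambda>g. hconst (f' g))" and f'': "z = (\<lambda>g. hconst (f'' g))"
    using y z unfolding carrier by (metis Hom_G_coeff_unitsE)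
  show "x \<otimes>\<^bsub>?P\<^esub> y \<otimes>\<^bsub>?P\<^esub> z = x \<otimes>\<^bsub>?P\<^esub> (y \<otimes>\<^bsub>?P\<^esub> z)"
    using mult[of f f'] mult[of f' f''] mult[of "\<lambda>g. f g * f' g" f''] mult[of f "\<lambda>g. f' g * f'' g"]
      closed[of x y] closed[of y z] x y z
    by (simp add: f(1) f' f'' mult.assoc)
qed

lemma tau_hconst:
  assumes "u 0 = hconst 1"
  shows "tau u (hconst c) = hconst c"
proof
  fix h
  have "{i \<in> hsupp (hconst c). h \<in> hsupp (hmonom (hconst c i) i \<otimes>\<^bsub>hahn_ring\<^esub> u i)} =
      (if c = 0 \<or> h \<noteq> 0 then {} else {0})"
    unfolding hmonom_mult using assms by (auto simp: hconst_def hmonom_def hsupp_def split: if_splits)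
  then show "tau u (hconst c) h = hconst c h"
    unfolding tau_def family_sum_def hmonom_mult using assms by (simp add: hconst_def hmonom_def)
qed

text \<open>The substitution \<open>\<tau>\<^sub>u\<close> fixes constant series, so it does nothing to the values of a character,
  and \<open>\<times>\<close> becomes the commutative pointwise product.\<close>

lemma times_group_coeff_units:
  "times_group (Hom_G coeff_units) =
    pointwise_group (Hom_G (coeff_units :: ('g::linordered_ab_group_add, 'k::field) series set))"
proof -
  have "(\<lambda>g. tau u (w g) \<otimes>\<^bsub>hahn_ring\<^esub> u g) = (\<lambda>g. u g \<otimes>\<^bsub>hahn_ring\<^esub> w g)"
    if uw: "u \<in> Hom_G coeff_units" "w \<in> Hom_G coeff_units" for u w :: "'g \<Rightarrow> ('g, 'k) series"
  proof -
    obtain f f' where "u = (\<lambda>g. hconst (f g))" "f 0 = 1" "w = (\<lambda>g. hconst (f' g))"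
      using uw by (metis Hom_G_coeff_unitsE)
    then show ?thesis
      by (simp add: tau_hconst hconst_mult_hconst mult.commute)
  qed
  then show ?thesis
    unfolding times_group_def pointwise_group_def
    by (auto simp: fun_eq_iff restrict_def)
qed


section \<open>The automorphisms induced by characters\<close>

lemma rho_hmonom:
  assumes "hahn_field K"
  shows "rho K x (hmonom c g) = hmonom (c * x g 0) g"
  using hmonom_in_hahn_field[OF assms] by (auto simp: rho_def hmonom_def)

lemma S_map_rho:
  assumes "hahn_field K" "x \<in> Hom_G coeff_units"
  shows "S_map (rho K x) = x"
proof -
  obtain f where "x = (\<lambda>g. hconst (f g))"
    using assms(2) by (auto elim: Hom_G_coeff_unitsE)
  then show ?thesis
    by (simp add: S_map_def rho_hmonom[OF assms(1)] hmonom_mult_hmonom)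
      (simp add: hconst_def hmonom_def)
qed

text \<open>Needed because the inverse of an automorphism agrees with a substitution on \<open>K\<close> only.\<close>

lemma K_summable_map_cong:
  assumes "hahn_field K" "\<And>a. a \<in> K \<Longrightarrow> \<sigma> a = \<sigma>' a"
  shows "K_summable_map K \<sigma> \<longleftrightarrow> K_summable_map K \<sigma>'"
  using assms hmonom_in_hahn_field[OF assms(1)] by (simp add: K_summable_map_def)

text \<open>The monomials of \<open>a\<close> are sent to nonzero monomials with the same exponents, so the family is
  summable because the support of \<open>a\<close> is well ordered. That the sum lies in \<open>K\<close> is the content of
  the second lifting property, which enters as the last assumption.\<close>

lemma K_summable_map_rho:
  assumes K: "hahn_field K" and x: "x \<in> Hom_G coeff_units" and into: "rho K x \<in> K \<rightarrow> K"
  shows "K_summable_map K (rho K x)"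
  unfolding K_summable_map_def K_summable_def
proof (intro ballI conjI)
  fix a assume a: "a \<in> K"
  obtain f where f: "x = (\<lambda>g. hconst (f g))" "\<And>g. f g \<noteq> 0"
    using x by (auto elim: Hom_G_coeff_unitsE)
  have eq: "rho K x (hmonom (a g) g) = hmonom (a g * f g) g" for g
    using rho_hmonom[OF K] by (simp add: f hconst_def hmonom_def)
  have nz: "\<And>g. g \<in> hsupp a \<Longrightarrow> a g * f g \<noteq> 0"
    using f(2) by (simp add: hsupp_def)
  show "summable_family (\<lambda>g. rho K x (hmonom (a g) g)) (hsupp a)"
    unfolding eq using hahn_field_wf[OF K a] nz by (rule summable_family_hmonom)
  show "rho K x (hmonom (a g) g) \<in> K" for g
    by (simp add: eq hmonom_in_hahn_field[OF K])
  have "family_sum (\<lambda>g. hmonom (a g * f g) g) (hsupp a) = (\<lambda>g. if g \<in> hsupp a then a g * f g else 0)"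
    using nz by (rule family_sum_hmonom)
  then show sum: "family_sum (\<lambda>g. rho K x (hmonom (a g) g)) (hsupp a) = rho K x a"
    unfolding eq using a by (auto simp: rho_def f(1) hsupp_def hconst_def hmonom_def fun_eq_iff)
  show "family_sum (\<lambda>g. rho K x (hmonom (a g) g)) (hsupp a) \<in> K"
    unfolding sum using into a by auto
qed

text \<open>Strong additivity of \<open>\<rho>\<^sub>x\<close> also concerns its inverse. This is \<open>\<rho>\<^sub>y\<close> for the inverse
  character \<open>y\<close>, to which the second lifting property applies as well.\<close>

lemma rho_in_strong_part:
  assumes K: "hahn_field K" and lift: "second_lifting K" and x: "x \<in> Hom_G coeff_units"
  shows "rho K x \<in> strong_part K (over_k (Int_Aut K))"
proof -
  have Int_Aut: "rho K y \<in> Int_Aut K" if "y \<in> Hom_G coeff_units" for y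
    using lift that by (auto simp: second_lifting_def hom_def pointwise_group_def aut_group_def)
  have into: "rho K y \<in> K \<rightarrow> K" if "y \<in> Hom_G coeff_units" for y
    using Int_Aut[OF that] by (auto simp: Int_Aut_def val_Aut_def ring_iso_def ring_hom_def)
  obtain f where f: "x = (\<lambda>g. hconst (f g))" "\<And>g. f g \<noteq> 0" "f 0 = 1"
    and inv: "(\<lambda>g. hconst (inverse (f g))) \<in> Hom_G coeff_units" (is "?y \<in> _")
    using x by (auto elim: Hom_G_coeff_unitsE)
  have "rho K x (hconst c) = hconst c" for c
    unfolding hconst_def rho_hmonom[OF K] by (simp add: f hconst_def hmonom_def)
  moreover have "inv_into K (rho K x) b = rho K ?y b" if b: "b \<in> K" for b
  proof (rule inv_into_f_eq)
    show "inj_on (rho K x) K"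
      using f(2) by (auto simp: inj_on_def rho_def f(1) hconst_def hmonom_def fun_eq_iff)
    show yb: "rho K ?y b \<in> K"
      using into[OF inv] b by auto
    show "rho K x (rho K ?y b) = b"
      using yb b f(2) by (simp add: rho_def f(1) hconst_def hmonom_def fun_eq_iff)
  qed
  then have "K_summable_map K (inv_into K (rho K x)) \<longleftrightarrow> K_summable_map K (rho K ?y)"
    by (rule K_summable_map_cong[OF K])
  ultimately show ?thesis
    using Int_Aut[OF x] K_summable_map_rho[OF K x into[OF x]] K_summable_map_rho[OF K inv into[OF inv]]
    by (simp add: strong_part_def over_k_def strongly_additive_def)
qed

lemma rho_hom_strong_part:
  assumes "hahn_field K" "second_lifting K"
  shows "rho K \<in> hom (pointwise_group (Hom_G coeff_units))
    (aut_group K (strong_part K (over_k (Int_Aut K))))"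
  using assms rho_in_strong_part[OF assms]
  by (simp add: second_lifting_def hom_def pointwise_group_def aut_group_def)


section \<open>The leading character\<close>

text \<open>The values are kept as constant series, so that the leading character lands in
  \<open>Hom_G coeff_units\<close> and is a retraction onto it.\<close>

definition leading_char :: "('g \<Rightarrow> ('g::linordered_ab_group_add, 'k::field) series) \<Rightarrow> 'g \<Rightarrow> ('g, 'k) series"
  where "leading_char u = (\<lambda>g. hconst (u g 0))"

lemma leading_char_coeff_units:
  "x \<in> Hom_G coeff_units \<Longrightarrow> leading_char x = x"
  by (erule Hom_G_coeff_unitsE) (simp add: leading_char_def hconst_def hmonom_def)

lemma leading_char_eq_one_iff: "leading_char u = (\<lambda>_. hconst 1) \<longleftrightarrow> (\<forall>g. u g 0 = 1)"
  by (metis hconst_eq_iff leading_char_def)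

text \<open>\<open>u 0\<close> is idempotent, and the field \<open>K\<close> has no nonzero idempotent except \<open>1\<close>.\<close>

lemma Hom_G_val_units_0:
  assumes K: "hahn_field K" and u: "u \<in> Hom_G (val_units K)"
  shows "u 0 = hconst 1"
proof -
  interpret field "ring_on K"
    using K by (simp add: hahn_field_def)
  have "u 0 \<in> K" "u 0 0 \<noteq> 0" "u 0 \<otimes>\<^bsub>hahn_ring\<^esub> u 0 = u 0"
    using u by (auto simp: Hom_G_iff val_units_iff[OF K]) (metis add.right_neutral)
  moreover from this have "u 0 \<noteq> \<zero>\<^bsub>hahn_ring\<^esub>"
    by (auto simp: hahn_ring_def)
  ultimately show ?thesis
    using m_lcancel[of "u 0" "u 0" "hconst 1"] r_one[of "u 0"] one_closed by (simp add: one_hahn_ring)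
qed

lemma leading_char_in_Hom_G:
  assumes K: "hahn_field K" and u: "u \<in> Hom_G (val_units K)"
  shows "leading_char u \<in> Hom_G coeff_units"
  using u unfolding Hom_G_coeff_units_iff leading_char_def
  by (intro exI[of _ "\<lambda>g. u g 0"]) (simp add: Hom_G_iff val_units_iff[OF K] mult_coeff_0)

text \<open>The term \<open>a\<^sub>g u(g) t\<^sup>g\<close> of \<open>\<tau>\<^sub>u(a)\<close> has only exponents \<open>\<ge> g\<close>. If all \<open>g\<close> are nonnegative, only
  \<open>g = 0\<close> can contribute to the exponent \<open>0\<close>, and it contributes \<open>a\<^sub>0\<close>. So \<open>\<tau>\<^sub>u\<close> induces the
  identity on residues.\<close>

lemma tau_nonneg:
  assumes K: "hahn_field K" and u: "u \<in> Hom_G (val_units K)" and a: "\<forall>g \<in> hsupp a. 0 \<le> g"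
  shows "\<forall>g \<in> hsupp (tau u a). 0 \<le> g" and "tau u a 0 = a 0"
proof -
  have nonneg: "\<And>g h. u g h \<noteq> 0 \<Longrightarrow> 0 \<le> h"
    using u by (auto simp: Hom_G_iff val_units_iff[OF K] hsupp_def)
  let ?I = "\<lambda>h. {g \<in> hsupp a. h \<in> hsupp (hmonom (a g) g \<otimes>\<^bsub>hahn_ring\<^esub> u g)}"
  have tau: "tau u a h = (\<Sum>g \<in> ?I h. a g * u g (h - g))" for h
    unfolding tau_def family_sum_def by (simp add: hmonom_mult)
  have le: "0 \<le> g" "g \<le> h" if "g \<in> ?I h" for g h
    using that a nonneg[of g "h - g"] by (auto simp: hmonom_mult hsupp_def)
  have "tau u a h = 0" if "h < 0" for h
  proof -
    have "?I h = {}"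
      using le[of _ h] that by force
    then show ?thesis
      by (simp only: tau sum.empty)
  qed
  then show "\<forall>g \<in> hsupp (tau u a). 0 \<le> g"
    unfolding hsupp_def using not_less by blast
  have u0: "u 0 0 = 1"
    using Hom_G_val_units_0[OF K u] by (simp add: hconst_def hmonom_def)
  have "?I 0 \<subseteq> {0}"
    using le[of _ 0] antisym by blast
  moreover have "0 \<in> ?I 0 \<longleftrightarrow> a 0 \<noteq> 0"
    unfolding hmonom_mult using u0 by (simp add: hsupp_def)
  ultimately have "?I 0 = (if a 0 = 0 then {} else {0})"
    by auto
  then show "tau u a 0 = a 0"
    using u0 by (simp add: tau)
qed

text \<open>Both factors of \<open>(u \<times> w)(g) = \<tau>\<^sub>u(w(g)) u(g)\<close> lie in the valuation ring, so their residues
  multiply, and \<open>\<tau>\<^sub>u\<close> does not change the residue of \<open>w(g)\<close>.\<close>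

lemma leading_char_hom:
  assumes K: "hahn_field K"
  shows "leading_char \<in> hom (times_group (Hom_plus K)) (pointwise_group (Hom_G coeff_units))"
proof (rule homI)
  show "leading_char u \<in> carrier (pointwise_group (Hom_G coeff_units))"
    if "u \<in> carrier (times_group (Hom_plus K))" for u
    using that leading_char_in_Hom_G[OF K]
    by (simp add: times_group_def pointwise_group_def Hom_plus_def)
  fix u w assume "u \<in> carrier (times_group (Hom_plus K))" "w \<in> carrier (times_group (Hom_plus K))"
  then have uw: "u \<in> Hom_plus K" "w \<in> Hom_plus K"
    by (simp_all add: times_group_def)
  then have Hom: "u \<in> Hom_G (val_units K)" "w \<in> Hom_G (val_units K)"
    by (simp_all add: Hom_plus_def)
  then have nonneg: "\<forall>h \<in> hsupp (u g). 0 \<le> h" "\<forall>h \<in> hsupp (w g). 0 \<le> h" for g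
    by (auto simp: Hom_G_iff val_units_iff[OF K])
  have "(tau u (w g) \<otimes>\<^bsub>hahn_ring\<^esub> u g) 0 = u g 0 * w g 0" for g
    using tau_nonneg[OF K Hom(1) nonneg(2)] nonneg(1) by (simp add: mult_coeff_0)
  then show "leading_char (u \<otimes>\<^bsub>times_group (Hom_plus K)\<^esub> w) =
      leading_char u \<otimes>\<^bsub>pointwise_group (Hom_G coeff_units)\<^esub> leading_char w"
    using uw leading_char_in_Hom_G[OF K] Hom
    by (simp add: times_group_def pointwise_group_def leading_char_def hconst_mult_hconst)
qed

lemma kernel_leading_char:
  assumes K: "hahn_field K"
  shows "kernel (times_group (Hom_plus K)) (pointwise_group (Hom_G coeff_units)) leading_char =
    Hom_plus_one K"
  using one_units_iff[OF K]
  by (auto simp: kernel_def times_group_def pointwise_group_def Hom_plus_one_def one_hahn_ring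
      leading_char_eq_one_iff Hom_plus_def Hom_G_iff)

text \<open>\<open>\<S> \<sigma> g\<close> is \<open>\<sigma>(t\<^sup>g)\<close> shifted by \<open>-g\<close>, which moves the coefficient at \<open>g\<close> to \<open>0\<close>.\<close>

lemma strong_part_one_Aut:
  "strong_part K (over_k (one_Aut K)) =
    {\<sigma> \<in> strong_part K (over_k (Int_Aut K)). leading_char (S_map \<sigma>) = (\<lambda>_. hconst 1)}"
  by (auto simp: strong_part_def over_k_def one_Aut_def leading_char_eq_one_iff S_map_def hmonom_mult)


section \<open>Kernels, retractions and restricted isomorphisms\<close>

text \<open>Every \<open>g\<close> shares its image under \<open>h\<close> with a unique \<open>r\<close> in \<open>R\<close>, and \<open>g = (g r\<^sup>-\<^sup>1) r\<close>.\<close>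

lemma (in group_hom) inner_semidirect_kernel:
  assumes R: "subgroup R G" and inj: "inj_on h R" and img: "h ` R = carrier H"
  shows "inner_semidirect G (kernel G H h) R"
  unfolding inner_semidirect_def
proof (intro conjI)
  show "kernel G H h \<lhd> G"
    by (rule normal_kernel)
  show "kernel G H h \<inter> R = {\<one>}"
  proof
    show "kernel G H h \<inter> R \<subseteq> {\<one>}"
      using inj subgroup.one_closed[OF R] by (auto simp: kernel_def inj_on_def)
  qed (use subgroup.one_closed[OF R] in \<open>auto simp: kernel_def\<close>)
  show "kernel G H h <#> R = carrier G"
  proof
    show "kernel G H h <#> R \<subseteq> carrier G"
      using subgroup.mem_carrier[OF R] by (auto simp: set_mult_def kernel_def)
    show "carrier G \<subseteq> kernel G H h <#> R"
    proof
      fix g assume g: "g \<in> carrier G"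
      then obtain r where r: "r \<in> R" "h r = h g"
        using img by (metis hom_closed imageE)
      then have rG: "r \<in> carrier G"
        using subgroup.mem_carrier[OF R] by blast
      have "g \<otimes> inv r \<in> kernel G H h"
        using g rG r(2) by (simp add: kernel_def)
      moreover have "g = (g \<otimes> inv r) \<otimes> r"
        using g rG by (simp add: G.m_assoc)
      ultimately show "g \<in> kernel G H h <#> R"
        using r(1) unfolding set_mult_def by blast
    qed
  qed
qed (rule R)

text \<open>The multiplication of \<open>times_group B\<close> is undefined outside \<open>B\<close>, hence not literally that of
  \<open>times_group B'\<close>; the two have to be compared on \<open>B'\<close>.\<close>

lemma iso_restrict_times_group:
  assumes "S \<in> iso (aut_group K A) (times_group B)" "A' \<subseteq> A" "S ` A' = B'"
  shows "S \<in> iso (aut_group K A') (times_group B')"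
proof -
  have "S ` A = B" "inj_on S A"
    using assms(1) by (auto simp: iso_def bij_betw_def aut_group_def times_group_def)
  then have "bij_betw S A' B'" "B' \<subseteq> B"
    using assms(2,3) by (auto simp: bij_betw_def inj_on_subset)
  moreover have "S (\<sigma> \<otimes>\<^bsub>aut_group K A'\<^esub> \<sigma>') = S \<sigma> \<otimes>\<^bsub>times_group B'\<^esub> S \<sigma>'"
    if "\<sigma> \<in> A'" "\<sigma>' \<in> A'" for \<sigma> \<sigma>'
  proof -
    have "S (\<sigma> \<otimes>\<^bsub>aut_group K A\<^esub> \<sigma>') = S \<sigma> \<otimes>\<^bsub>times_group B\<^esub> S \<sigma>'"
      using assms(1,2) that by (auto simp: iso_def hom_def aut_group_def)
    moreover have "S \<sigma> \<in> B'" "S \<sigma>' \<in> B'"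
      using that assms(3) by auto
    ultimately show ?thesis
      using \<open>B' \<subseteq> B\<close> by (auto simp: aut_group_def times_group_def subset_iff)
  qed
  ultimately show ?thesis
    by (auto simp: iso_def hom_def aut_group_def times_group_def bij_betw_def)
qed

theorem corollary4p2p7:
  fixes K :: "('g::linordered_ab_group_add, 'k::field) series set"
  assumes "hahn_field K"
    and "second_lifting K"
    and "S_isomorphism K"
  shows "subgroup (G_Exp K) (aut_group K (strong_part K (over_k (Int_Aut K)))) \<and>
      S_map \<in> iso (aut_group K (G_Exp K)) (times_group (Hom_G coeff_units)) \<and>
      times_group (Hom_G coeff_units) = pointwise_group (Hom_G (coeff_units :: ('g, 'k) series set)) \<and>
      subgroup (strong_part K (over_k (one_Aut K))) (aut_group K (strong_part K (over_k (Int_Aut K)))) \<and>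
      S_map \<in> iso (aut_group K (strong_part K (over_k (one_Aut K)))) (times_group (Hom_plus_one K)) \<and>
      inner_semidirect (times_group (Hom_plus K)) (Hom_plus_one K) (Hom_G coeff_units)"
proof -
  let ?A = "strong_part K (over_k (Int_Aut K))" and ?A1 = "strong_part K (over_k (one_Aut K))"
  let ?AG = "aut_group K ?A" and ?U = "times_group (Hom_plus K)"
  let ?P = "pointwise_group (Hom_G (coeff_units :: ('g, 'k) series set))"
  note K = assms(1)
  have groups: "group ?AG" "group ?U" and S: "S_map \<in> iso ?AG ?U"
    using assms(3) by (auto simp: S_isomorphism_def)
  have carriers: "carrier ?AG = ?A" "carrier ?U = Hom_plus K" "carrier ?P = Hom_G coeff_units"
    "\<one>\<^bsub>?P\<^esub> = (\<lambda>_. hconst 1)"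
    by (simp_all add: aut_group_def times_group_def pointwise_group_def one_hahn_ring)
  have S_img: "S_map ` ?A = Hom_plus K"
    using S by (simp add: iso_def bij_betw_def carriers)
  interpret rho: group_hom ?P ?AG "rho K"
    using rho_hom_strong_part[OF assms(1,2)] group_pointwise_coeff_units groups(1)
    by (intro group_hom.intro group_hom_axioms.intro)
  interpret S: group_hom ?AG ?U S_map
    using S groups by (intro group_hom.intro group_hom_axioms.intro) (auto simp: iso_def)
  interpret lead: group_hom ?U ?P leading_char
    using leading_char_hom[OF K] groups(2) group_pointwise_coeff_units
    by (intro group_hom.intro group_hom_axioms.intro)

  have Exp: "subgroup (G_Exp K) ?AG"
    using rho.img_is_subgroup by (simp add: G_Exp_def carriers)
  have S_Exp: "S_map ` G_Exp K = Hom_G coeff_units"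
    using S_map_rho[OF K] by (force simp: G_Exp_def image_image)
  have one: "subgroup ?A1 ?AG"
  proof -
    interpret group_hom ?AG ?P "leading_char \<circ> S_map"
      using hom_compose[OF S.homh lead.homh]
      by (intro group_hom.intro group_hom_axioms.intro groups group_pointwise_coeff_units)
    have "kernel ?AG ?P (leading_char \<circ> S_map) = ?A1"
      by (simp add: kernel_def carriers strong_part_one_Aut)
    then show ?thesis
      using subgroup_kernel by simp
  qed
  have "Hom_plus_one K = {u \<in> S_map ` ?A. leading_char u = (\<lambda>_. hconst 1)}"
    using kernel_leading_char[OF K] by (simp add: kernel_def carriers S_img)
  then have S_one: "S_map ` ?A1 = Hom_plus_one K"
    by (auto simp: strong_part_one_Aut)
  have "subgroup (Hom_G coeff_units) ?U"
    using S.subgroup_img_is_subgroup[OF Exp] by (simp add: S_Exp)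
  moreover have "inj_on leading_char (Hom_G coeff_units)"
    by (simp add: inj_on_def leading_char_coeff_units)
  moreover have "leading_char ` Hom_G coeff_units = carrier ?P"
    by (simp add: carriers leading_char_coeff_units cong: image_cong)
  ultimately have "inner_semidirect ?U (kernel ?U ?P leading_char) (Hom_G coeff_units)"
    by (rule lead.inner_semidirect_kernel)
  then show ?thesis
    using Exp one iso_restrict_times_group[OF S _ S_Exp] iso_restrict_times_group[OF S _ S_one]
      subgroup.subset[OF Exp] subgroup.subset[OF one] times_group_coeff_units
    by (simp add: carriers kernel_leading_char[OF K])
qed

end
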